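(* Let $M$ be a real symmetric matrix indexed by a finite set $V$ and suppose distinct $a,b\in V$ are strongly cospectral for $M$ with common eigenvalue support \[ \{a_0-b_0\sqrt\Delta,\ a_0,\ a_0+b_0\sqrt\Delta\},\qquad a_0,b_0\in\mathbb Q,\quad b_0>0, \] where $\Delta>1$ is a square-free integer. Suppose the signs at the two outer values $a_0\pm b_0\sqrt\Delta$ agree and are opposite to the sign at $a_0$. Then \[ \mathcal K(M;a,b)=\begin{cases}\mathbb N^+,&a_0=0,\\ \{1\},&a_0\neq0.\end{cases} \] In the second case the minimum positive transfer time (under $M$) is $\pi/(b_0\sqrt\Delta)$.
   Context: $\mathbb N^+=\{1,2,3,\ldots\}$. $e_v$ denotes the standard basis vector indexed by $v\in V$. For a real symmetric matrix $M$ with spectral decomposition $M=\sum_{\lambda\in\operatorname{Spec}(M)}\lambda E_\lambda$ ($E_\lambda$ the orthogonal projection onto the $\lambda$-eigenspace), put $\operatorname{supp}_M(x)=\{\lambda\in\operatorname{Spec}(M):E_\lambda x\neq 0\}$. Elements $a,b$ of $V$ are strongly cospectral for $M$ if $\operatorname{supp}_M(e_a)=\operatorname{supp}_M(e_b)$ (the common eigenvalue support) and for each $\lambda$ in it $E_\lambda e_b=\sigma_\lambda E_\lambda e_a$ with $\sigma_\lambda\in\{1,-1\}$; $\sigma_\lambda$ is the sign at $\lambda$. A real symmetric matrix $K$ has perfect state transfer (PST) from $a$ to $b$ at time $\tau>0$ (a transfer time) if $\exp(-\mathrm i\tau K)e_a=\gamma e_b$ for some $\gamma\in\mathbb C$ with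 $|\gamma|=1$; it has PST from $a$ to $b$ if this holds for some $\tau>0$. $\mathcal K(M;a,b)=\{k\in\mathbb N^+:M^k\text{ has PST from }a\text{ to }b\}$. *)

theory Defs
  imports "HOL-Analysis.Analysis" "HOL-Computational_Algebra.Squarefree"
begin

definition eigenspace :: "real^'v^'v \<Rightarrow> real \<Rightarrow> (real^'v) set" where
  "eigenspace M l = {x. M *v x = l *s x}"

definition Spec :: "real^'v^'v \<Rightarrow> real set" where
  "Spec M = {l. \<exists>x. x \<noteq> 0 \<and> M *v x = l *s x}"

definition orth_proj :: "'a::euclidean_space set \<Rightarrow> 'a \<Rightarrow> 'a" where
  "orth_proj S x = (THE y. y \<in> S \<and> (\<forall>z\<in>S. orthogonal (x - y) z))"

lemma orth_proj_unique:
  fixes S :: "'a::euclidean_space set"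
  assumes "subspace S"
  shows "\<exists>!y. y \<in> S \<and> (\<forall>z\<in>S. orthogonal (x - y) z)"
proof -
  obtain y w where y: "y \<in> span S" and w: "\<And>z. z \<in> span S \<Longrightarrow> orthogonal w z" and x: "x = y + w"
    using orthogonal_subspace_decomp_exists[of S x] by metis
  show ?thesis
  proof (rule ex1I[of _ y])
    show "y \<in> S \<and> (\<forall>z\<in>S. orthogonal (x - y) z)"
      using y w x assms by (simp add: span_eq_iff[THEN iffD2])
  next
    fix y' assume y': "y' \<in> S \<and> (\<forall>z\<in>S. orthogonal (x - y') z)"
    have S: "span S = S" using assms by (simp add: span_eq_iff)
    have mem: "y - y' \<in> S" using y y' S assms by (simp add: subspace_diff)
    then have "(x - y') \<bullet> (y - y') = 0" "(x - y) \<bullet> (y - y') = 0"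
      using y' w x S by (auto simp: orthogonal_def)
    then have "(y - y') \<bullet> (y - y') = 0" by (simp add: inner_diff_left)
    then show "y' = y" by simp
  qed
qed

lemma subspace_eigenspace: "subspace (eigenspace M l)"
  by (auto simp: subspace_def eigenspace_def matrix_vector_right_distrib
      matrix_vector_mult_scaleR vec_eq_iff algebra_simps)

definition eigenproj :: "real^'v^'v \<Rightarrow> real \<Rightarrow> real^'v \<Rightarrow> real^'v" where
  "eigenproj M l = orth_proj (eigenspace M l)"

definition eigsupp :: "real^'v^'v \<Rightarrow> real^'v \<Rightarrow> real set" where
  "eigsupp M x = {l \<in> Spec M. eigenproj M l x \<noteq> 0}"

definition strongly_cospectral :: "real^'v^'v \<Rightarrow> 'v \<Rightarrow> 'v \<Rightarrow> bool" where
  "strongly_cospectral M a b \<longleftrightarrow>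
     eigsupp M (axis a 1) = eigsupp M (axis b 1) \<and>
     (\<forall>l\<in>eigsupp M (axis a 1). \<exists>s\<in>{1, -1}.
        eigenproj M l (axis b 1) = s *s eigenproj M l (axis a 1))"

text \<open>For strongly cospectral elements, the sign is uniquely determined at every point of the
  common eigenvalue support, since the projection of the basis vector is nonzero there; elsewhere
  the value is irrelevant.\<close>

definition cosp_sign :: "real^'v^'v \<Rightarrow> 'v \<Rightarrow> 'v \<Rightarrow> real \<Rightarrow> real" where
  "cosp_sign M a b l =
     (THE s. s \<in> {1, -1} \<and> eigenproj M l (axis b 1) = s *s eigenproj M l (axis a 1))"

text \<open>The overloaded power and exponential are not available for the matrix product: the
  type class multiplication on vectors is componentwise.\<close>

primrec matpow :: "'a::semiring_1^'v^'v \<Rightarrow> nat \<Rightarrow> 'a^'v^'v" where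
  "matpow A 0 = mat 1"
| "matpow A (Suc k) = matpow A k ** A"

definition mexp :: "complex^'v^'v \<Rightarrow> complex^'v^'v" where
  "mexp A = (\<Sum>k. (1 / fact k) *\<^sub>R matpow A k)"

lemma summable_mexp:
  fixes A :: "complex^'v^'v"
  shows "summable (\<lambda>k. (1 / fact k) *\<^sub>R matpow A k)"
proof -
  define C where "C = (\<Sum>i\<in>UNIV. \<Sum>j\<in>UNIV. cmod (A $ i $ j))"
  have C0: "C \<ge> 0" unfolding C_def by (intro sum_nonneg) auto
  have col: "(\<Sum>i\<in>UNIV. cmod (A $ i $ j)) \<le> C" for j
    unfolding C_def by (intro sum_mono member_le_sum) auto
  have bd: "cmod (matpow A k $ i $ j) \<le> C ^ k" for k i j
  proof (induction k arbitrary: i j)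
    case 0
    show ?case by (simp add: mat_def)
  next
    case (Suc k)
    have "cmod (matpow A (Suc k) $ i $ j) \<le> (\<Sum>m\<in>UNIV. cmod (matpow A k $ i $ m * A $ m $ j))"
      by (simp add: matrix_matrix_mult_def norm_sum)
    also have "\<dots> \<le> (\<Sum>m\<in>UNIV. C ^ k * cmod (A $ m $ j))"
      by (intro sum_mono) (simp add: norm_mult mult_right_mono Suc.IH)
    also have "\<dots> \<le> C ^ k * C"
      unfolding sum_distrib_left[symmetric] using col C0 by (intro mult_left_mono) auto
    finally show ?case by (simp add: mult.commute)
  qed
  have nb: "norm (matpow A k) \<le> real (CARD('v)) * (real (CARD('v)) * C ^ k)" for k
  proof -
    have "norm (matpow A k) \<le> (\<Sum>i\<in>UNIV. norm (matpow A k $ i))"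
      unfolding norm_vec_def by (rule L2_set_le_sum) simp
    also have "\<dots> \<le> (\<Sum>i\<in>(UNIV::'v set). \<Sum>j\<in>(UNIV::'v set). C ^ k)"
    proof (rule sum_mono)
      fix i :: 'v
      have "norm (matpow A k $ i) \<le> (\<Sum>j\<in>UNIV. cmod (matpow A k $ i $ j))"
        unfolding norm_vec_def by (rule L2_set_le_sum) simp
      also have "\<dots> \<le> (\<Sum>j\<in>(UNIV::'v set). C ^ k)" by (intro sum_mono bd)
      finally show "norm (matpow A k $ i) \<le> (\<Sum>j\<in>(UNIV::'v set). C ^ k)" .
    qed
    finally show ?thesis by simp
  qed
  have "summable (\<lambda>k. (real CARD('v) * real CARD('v)) * (inverse (fact k) * C ^ k))"
    by (intro summable_mult summable_exp)
  then show ?thesis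
  proof (rule summable_comparison_test')
    fix k :: nat
    show "norm ((1 / fact k) *\<^sub>R matpow A k)
        \<le> (real CARD('v) * real CARD('v)) * (inverse (fact k) * C ^ k)"
      using mult_left_mono[OF nb, of "1 / fact k" k] by (simp add: field_simps)
  qed
qed

definition pst_at :: "real^'v^'v \<Rightarrow> 'v \<Rightarrow> 'v \<Rightarrow> real \<Rightarrow> bool" where
  "pst_at K a b \<tau> \<longleftrightarrow> \<tau> > 0 \<and>
     (\<exists>\<gamma>::complex. cmod \<gamma> = 1 \<and>
        mexp (map_matrix (\<lambda>z. - \<i> * of_real \<tau> * of_real z) K) *v axis a 1 = \<gamma> *s axis b 1)"

definition pst :: "real^'v^'v \<Rightarrow> 'v \<Rightarrow> 'v \<Rightarrow> bool" where
  "pst K a b \<longleftrightarrow> (\<exists>\<tau>. pst_at K a b \<tau>)"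

definition pst_powers :: "real^'v^'v \<Rightarrow> 'v \<Rightarrow> 'v \<Rightarrow> nat set" where
  "pst_powers M a b = {k. k \<ge> 1 \<and> pst (matpow M k) a b}"

end

theory Submission
  imports Defs
begin

text \<open>The vector at a is the sum of its projections onto the three eigenspaces, and the vector
  at b is the sum of the same projections with signs. Comparing coefficients, state transfer for
  the k-th power of M at a given time only constrains the phases at the k-th powers of the three
  eigenvalues: the two outer phases must agree and be opposite to the middle one. For a nonzero
  centre a0 write the k-th powers of the outer eigenvalues as P + Q sqrt d and P - Q sqrt d with
  rational P and Q. The phase conditions make (P - a0 ^ k) / (Q sqrt d) rational, hence
  P = a0 ^ k. But P - a0 ^ k is a sum of terms of equal sign, nonzero for k at least 2.\<close>

section \<open>Spectral decomposition of a real symmetric matrix\<close>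

lemma symmetric_inner_commute:
  fixes M :: "real^'v^'v"
  assumes "transpose M = M"
  shows "(M *v x) \<bullet> y = x \<bullet> (M *v y)"
  by (metis assms dot_lmul_matrix transpose_matrix_vector)

text \<open>Moving \<open>M\<close> across the inner product evaluates
  \<open>(M *v x) \<bullet> y\<close> with either eigenvalue.\<close>

lemma eigenvectors_orthogonal:
  fixes M :: "real^'v^'v"
  assumes "transpose M = M" "M *v x = l *s x" "M *v y = m *s y" "l \<noteq> m"
  shows "x \<bullet> y = 0"
proof -
  have "l * (x \<bullet> y) = m * (x \<bullet> y)"
    using symmetric_inner_commute[OF assms(1), of x y] assms(2,3)
    by (simp add: scalar_mult_eq_scaleR)
  then show ?thesis using assms(4) by simp
qed

text \<open>A maximiser of the Rayleigh quotient on an invariant subspace is an eigenvector.\<close>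

lemma symmetric_invariant_subspace_eigenvector:
  fixes M :: "real^'v^'v"
  assumes sym: "transpose M = M" and W: "subspace W"
    and inv: "\<And>x. x \<in> W \<Longrightarrow> M *v x \<in> W" and ne: "W \<noteq> {0}"
  obtains x l where "x \<in> W" "x \<noteq> 0" "M *v x = l *s x"
proof -
  let ?S = "W \<inter> sphere 0 1"
  have "compact ?S"
    using closed_subspace[OF W] by (simp add: closed_Int_compact)
  moreover have "?S \<noteq> {}"
  proof -
    obtain w where w: "w \<in> W" "w \<noteq> 0" using ne subspace_0[OF W] by blast
    then have "w /\<^sub>R norm w \<in> ?S" using W by (simp add: subspace_scale)
    then show ?thesis by blast
  qed
  moreover have "continuous_on ?S (\<lambda>x. x \<bullet> (M *v x))"
    by (intro continuous_intros linear_continuous_on) auto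
  ultimately obtain x where x: "x \<in> ?S" and mx: "\<And>y. y \<in> ?S \<Longrightarrow> y \<bullet> (M *v y) \<le> x \<bullet> (M *v x)"
    using continuous_attains_sup[of ?S "\<lambda>x. x \<bullet> (M *v x)"] by blast
  define l where "l = x \<bullet> (M *v x)"
  have xW: "x \<in> W" and nx: "x \<bullet> x = 1" using x by (auto simp: norm_eq_1)
  have form: "y \<bullet> (M *v y) \<le> l * (y \<bullet> y)" if "y \<in> W" for y
  proof (cases "y = 0")
    case False
    then have "y /\<^sub>R norm y \<in> ?S" using that W by (simp add: subspace_scale)
    then have "(y /\<^sub>R norm y) \<bullet> (M *v (y /\<^sub>R norm y)) \<le> l"
      unfolding l_def by (rule mx)
    then have "(y \<bullet> (M *v y)) / (norm y)\<^sup>2 \<le> l"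
      by (simp add: matrix_vector_mult_scaleR power2_eq_square field_simps)
    then show ?thesis using False by (simp add: field_simps power2_norm_eq_inner)
  qed simp
  define w where "w = l *\<^sub>R x - M *v x"
  have wW: "w \<in> W" unfolding w_def using xW inv W by (simp add: subspace_diff subspace_scale)
  \<comment> \<open>The form l |y|^2 - y . M y is nonnegative on W and vanishes at x, so its first variation
    at x in the direction of w vanishes; that variation is 2 |w|^2.\<close>
  have quad: "0 \<le> 2 * t * (w \<bullet> w) + t\<^sup>2 * (l * (w \<bullet> w) - w \<bullet> (M *v w))" for t
  proof -
    have "x + t *\<^sub>R w \<in> W" using xW wW W by (simp add: subspace_add subspace_scale)
    from form[OF this] have "0 \<le> l * ((x + t *\<^sub>R w) \<bullet> (x + t *\<^sub>R w)) -
        (x + t *\<^sub>R w) \<bullet> (M *v (x + t *\<^sub>R w))" by simp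
    also have "\<dots> = l * (x \<bullet> x) - x \<bullet> (M *v x) + 2 * t * (l * (x \<bullet> w) - (M *v x) \<bullet> w)
        + t\<^sup>2 * (l * (w \<bullet> w) - w \<bullet> (M *v w))"
      using symmetric_inner_commute[OF sym, of x w]
      by (simp add: matrix_vector_right_distrib matrix_vector_mult_scaleR inner_add_left
          inner_add_right inner_commute algebra_simps power2_eq_square)
    also have "\<dots> = 2 * t * (w \<bullet> w) + t\<^sup>2 * (l * (w \<bullet> w) - w \<bullet> (M *v w))"
      using nx by (simp add: w_def l_def inner_diff_left inner_diff_right algebra_simps)
    finally show ?thesis .
  qed
  have "w \<bullet> w = 0"
  proof (rule ccontr)
    assume "w \<bullet> w \<noteq> 0"
    then have p: "w \<bullet> w > 0" by (simp add: inner_gt_zero_iff)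
    define c where "c = l * (w \<bullet> w) - w \<bullet> (M *v w)"
    \<comment> \<open>A negative step so short that the quadratic term in \<open>quad\<close> cannot
      outweigh the linear one, which makes the right-hand side of \<open>quad\<close>
      negative.\<close>
    define t where "t = - (w \<bullet> w) / (\<bar>c\<bar> + 1)"
    have t: "t < 0" unfolding t_def using p by (simp add: field_simps)
    have "- t * c \<le> - t * \<bar>c\<bar>" using t by (intro mult_left_mono) auto
    also have "\<dots> \<le> w \<bullet> w" unfolding t_def using p by (simp add: field_simps)
    finally have "2 * (w \<bullet> w) + t * c > 0" using p by linarith
    then have "t * (2 * (w \<bullet> w) + t * c) < 0" using t by (simp add: mult_neg_pos)
    then show False using quad[of t] by (simp add: c_def power2_eq_square algebra_simps)
  qed
  then have "M *v x = l *s x" by (simp add: w_def scalar_mult_eq_scaleR)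
  moreover have "x \<noteq> 0" using nx by auto
  ultimately show ?thesis using xW that by blast
qed

text \<open>Completeness of the eigenvectors. Their orthogonal complement \<open>W\<close> is
  invariant under \<open>M\<close>, and an eigenvector inside \<open>W\<close> would be orthogonal
  to itself; so the existence of eigenvectors in nonzero invariant subspaces forces
  \<open>W = {0}\<close>.\<close>

lemma orthogonal_to_eigenvectors_imp_0:
  fixes M :: "real^'v^'v"
  assumes sym: "transpose M = M"
    and orth: "\<And>z l. M *v z = l *s z \<Longrightarrow> y \<bullet> z = 0"
  shows "y = 0"
proof -
  define W where "W = {x. \<forall>z l. M *v z = l *s z \<longrightarrow> x \<bullet> z = 0}"
  have "subspace W" by (auto simp: W_def subspace_def inner_add_left)
  moreover have "M *v x \<in> W" if "x \<in> W" for x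
    using that by (auto simp: W_def symmetric_inner_commute[OF sym] scalar_mult_eq_scaleR)
  moreover have "\<not> (x \<in> W \<and> x \<noteq> 0 \<and> M *v x = l *s x)" for x l
    using inner_eq_zero_iff[of x] unfolding W_def by blast
  ultimately have "W = {0}"
    using symmetric_invariant_subspace_eigenvector[OF sym] by metis
  moreover have "y \<in> W" using orth by (auto simp: W_def)
  ultimately show ?thesis by simp
qed

section \<open>Eigenprojections and the resolution of a vector\<close>

lemma orth_proj_props:
  assumes "subspace S"
  shows "orth_proj S x \<in> S" and "z \<in> S \<Longrightarrow> (x - orth_proj S x) \<bullet> z = 0"
proof -
  have "orth_proj S x \<in> S \<and> (\<forall>z\<in>S. orthogonal (x - orth_proj S x) z)"
    unfolding orth_proj_def by (rule theI'[OF orth_proj_unique[OF assms]])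
  then show "orth_proj S x \<in> S" and "z \<in> S \<Longrightarrow> (x - orth_proj S x) \<bullet> z = 0"
    by (auto simp: orthogonal_def)
qed

lemma eigenproj_eigenvector: "M *v eigenproj M l x = l *s eigenproj M l x"
  using orth_proj_props(1)[OF subspace_eigenspace] by (auto simp: eigenproj_def eigenspace_def)

lemma eigenproj_residual_orthogonal:
  "M *v z = l *s z \<Longrightarrow> (x - eigenproj M l x) \<bullet> z = 0"
  using orth_proj_props(2)[OF subspace_eigenspace] by (auto simp: eigenproj_def eigenspace_def)

lemma eigenproj_orthogonal:
  assumes "transpose M = M" "l \<noteq> m"
  shows "eigenproj M l x \<bullet> eigenproj M m y = 0"
  using eigenvectors_orthogonal[OF assms(1) eigenproj_eigenvector eigenproj_eigenvector assms(2)] .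

text \<open>The projections at points of the support are nonzero and pairwise orthogonal. They are
  therefore finite in number, and no two points share a projection.\<close>

lemma finite_eigsupp:
  assumes sym: "transpose M = M"
  shows "finite (eigsupp M x)"
proof (rule finite_imageD)
  show inj: "inj_on (\<lambda>l. eigenproj M l x) (eigsupp M x)"
  proof (rule inj_onI, rule ccontr)
    fix l m assume "l \<in> eigsupp M x" "eigenproj M l x = eigenproj M m x" "l \<noteq> m"
    then show False using eigenproj_orthogonal[OF sym, of l m x x] by (auto simp: eigsupp_def)
  qed
  show "finite ((\<lambda>l. eigenproj M l x) ` eigsupp M x)"
    by (rule pairwise_orthogonal_imp_finite)
      (auto simp: pairwise_def orthogonal_def intro!: eigenproj_orthogonal[OF sym])
qed

text \<open>The difference of the two sides is orthogonal to every eigenvector, so completeness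
  makes it vanish.\<close>

lemma sum_eigenproj:
  assumes sym: "transpose M = M"
  shows "(\<Sum>l\<in>eigsupp M x. eigenproj M l x) = x"
proof -
  let ?A = "eigsupp M x" and ?P = "\<lambda>l. eigenproj M l x"
  have fin: "finite ?A" by (rule finite_eigsupp[OF sym])
  have "x - sum ?P ?A = 0"
  proof (rule orthogonal_to_eigenvectors_imp_0[OF sym])
    fix z m assume z: "M *v z = m *s z"
    have off: "?P l \<bullet> z = 0" if "l \<noteq> m" for l
      using eigenvectors_orthogonal[OF sym eigenproj_eigenvector z that] .
    show "(x - sum ?P ?A) \<bullet> z = 0"
    proof (cases "m \<in> ?A")
      case True
      have "sum ?P ?A \<bullet> z = ?P m \<bullet> z + (\<Sum>l\<in>?A - {m}. ?P l \<bullet> z)"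
        using fin True by (simp add: inner_sum_left inner_add_left sum.remove[of _ m])
      also have "\<dots> = ?P m \<bullet> z" using off by simp
      finally show ?thesis
        using eigenproj_residual_orthogonal[OF z, of x] by (simp add: inner_diff_left)
    next
      case False
      have "sum ?P ?A \<bullet> z = 0"
        unfolding inner_sum_left using False by (intro sum.neutral ballI off) blast
      moreover have "x \<bullet> z = 0"
      proof (cases "z = 0")
        case False
        \<comment> \<open>A nonzero \<open>z\<close> puts \<open>m\<close> into
          \<open>Spec M\<close>, so absence from the support can only mean a zero
          projection.\<close>
        then have "?P m = 0" using z \<open>m \<notin> ?A\<close> by (auto simp: eigsupp_def Spec_def)
        then show ?thesis using eigenproj_residual_orthogonal[OF z, of x] by simp
      qed simp
      ultimately show ?thesis by (simp add: inner_diff_left)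
    qed
  qed
  then show ?thesis by simp
qed

section \<open>Perfect state transfer in terms of the eigenvalue support\<close>

text \<open>Complexification: the spectral data of \<open>M\<close> are real, while the exponential
  in \<open>pst_at\<close> acts on complex vectors.\<close>

definition cvec :: "real^'v \<Rightarrow> complex^'v" where
  "cvec x = (\<chi> i. of_real (x $ i))"

lemma cvec_axis: "cvec (axis a 1) = axis a 1"
  by (simp add: cvec_def axis_def vec_eq_iff)

lemma cvec_sum: "cvec (\<Sum>l\<in>A. f l) = (\<Sum>l\<in>A. cvec (f l))"
  by (simp add: cvec_def vec_eq_iff)

lemma cvec_scale: "cvec (c *s x) = of_real c *s cvec x"
  by (simp add: cvec_def vec_eq_iff)

lemma matrix_vector_mult_sum_right:
  "A *v (\<Sum>l\<in>S. f l) = (\<Sum>l\<in>S. A *v f l)"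
  by (induction S rule: infinite_finite_induct) (simp_all add: matrix_vector_right_distrib)

lemma map_matrix_mult_cvec:
  assumes "K *v x = l *s x"
  shows "map_matrix (\<lambda>z. c * of_real z) K *v cvec x = (c * of_real l) *s cvec x"
proof -
  have "(\<Sum>j\<in>UNIV. c * of_real (K $ i $ j) * of_real (x $ j)) = c * of_real l * of_real (x $ i)" for i
  proof -
    have "(\<Sum>j\<in>UNIV. K $ i $ j * x $ j) = l * x $ i"
      using arg_cong[OF assms, of "\<lambda>v. v $ i"] by (simp add: matrix_vector_mult_def)
    from arg_cong[OF this, of "\<lambda>r. c * of_real r"] show ?thesis
      by (simp add: sum_distrib_left mult.assoc)
  qed
  then show ?thesis
    by (simp add: vec_eq_iff matrix_vector_mult_def map_matrix_def cvec_def)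
qed

lemma matpow_eigenvector:
  fixes A :: "'a::field^'v^'v"
  assumes "A *v x = c *s x"
  shows "matpow A k *v x = c ^ k *s x"
proof (induction k)
  case (Suc k)
  have "matpow A (Suc k) *v x = matpow A k *v (c *s x)"
    by (simp add: matrix_vector_mul_assoc[symmetric] assms)
  also have "\<dots> = c *s (matpow A k *v x)" by (rule vec.scale)
  finally show ?case by (simp add: Suc.IH vector_smult_assoc)
qed simp

text \<open>Evaluation at \<open>x\<close> is a bounded linear map on matrices, so it passes through
  the exponential series and leaves the scalar series of \<open>exp c\<close>.\<close>

lemma mexp_eigenvector:
  assumes "A *v x = c *s x"
  shows "mexp A *v x = exp c *s x"
proof -
  have lin: "bounded_linear (\<lambda>B::complex^'a^'a. B *v x)"
    by (intro linear_conv_bounded_linear[THEN iffD1] linearI)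
      (auto simp: vec_eq_iff matrix_vector_mult_def scaleR_sum_right sum.distrib algebra_simps)
  have "(\<lambda>k. ((1 / fact k) *\<^sub>R matpow A k) *v x) sums (mexp A *v x)"
    unfolding mexp_def by (rule bounded_linear.sums[OF lin summable_sums[OF summable_mexp]])
  moreover have "((1 / fact k) *\<^sub>R matpow A k) *v x = (c ^ k /\<^sub>R fact k) *s x" for k
  proof -
    have "((1 / fact k) *\<^sub>R matpow A k) *v x = (1 / fact k) *\<^sub>R (matpow A k *v x)"
      using linear_cmul[OF bounded_linear.linear[OF lin]] .
    then show ?thesis
      by (simp add: matpow_eigenvector[OF assms] vec_eq_iff divide_inverse)
  qed
  moreover have "(\<lambda>k. (c ^ k /\<^sub>R fact k) *s x) sums (exp c *s x)"
  proof -
    have "bounded_linear (\<lambda>r::complex. r *s x)"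
      by (intro linear_conv_bounded_linear[THEN iffD1] linearI)
        (auto simp: vec_eq_iff algebra_simps)
    then show ?thesis by (rule bounded_linear.sums[OF _ exp_converges])
  qed
  ultimately show ?thesis by (simp add: sums_unique2)
qed

text \<open>A nonzero projection determines the sign uniquely, which makes the definite description
  in \<open>cosp_sign\<close> meaningful on the support.\<close>

lemma strongly_cospectral_sign:
  assumes sc: "strongly_cospectral M a b" and l: "l \<in> eigsupp M (axis a 1)"
  shows "cosp_sign M a b l \<in> {1, -1}"
    and "eigenproj M l (axis b 1) = cosp_sign M a b l *s eigenproj M l (axis a 1)"
proof -
  have nz: "eigenproj M l (axis a 1) \<noteq> 0" using l by (simp add: eigsupp_def)
  have "\<exists>!s. s \<in> {1, -1} \<and> eigenproj M l (axis b 1) = s *s eigenproj M l (axis a 1)"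
  proof (rule ex_ex1I)
    show "\<exists>s. s \<in> {1, -1} \<and> eigenproj M l (axis b 1) = s *s eigenproj M l (axis a 1)"
      using sc l unfolding strongly_cospectral_def by blast
  next
    fix s t assume "s \<in> {1, -1} \<and> eigenproj M l (axis b 1) = s *s eigenproj M l (axis a 1)"
      "t \<in> {1, -1} \<and> eigenproj M l (axis b 1) = t *s eigenproj M l (axis a 1)"
    then show "s = t" using nz by (metis vector_mul_rcancel)
  qed
  from theI'[OF this, folded cosp_sign_def]
  show "cosp_sign M a b l \<in> {1, -1}"
    and "eigenproj M l (axis b 1) = cosp_sign M a b l *s eigenproj M l (axis a 1)" by auto
qed

text \<open>Pairing both sums with the real vector \<open>u m\<close> kills every term except the
  one at \<open>m\<close>.\<close>

lemma orthogonal_cvec_coeff_eq: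
  fixes u :: "'i \<Rightarrow> real^'v"
  assumes fin: "finite A" and m: "m \<in> A" and nz: "u m \<noteq> 0"
    and orth: "\<And>l. l \<in> A \<Longrightarrow> l \<noteq> m \<Longrightarrow> u l \<bullet> u m = 0"
    and eq: "(\<Sum>l\<in>A. c l *s cvec (u l)) = (\<Sum>l\<in>A. d l *s cvec (u l))"
  shows "c m = d m"
proof -
  have pair: "(\<Sum>i\<in>UNIV. (\<Sum>l\<in>A. f l *s cvec (u l)) $ i * of_real (u m $ i)) =
      f m * of_real (u m \<bullet> u m)" for f
  proof -
    have "(\<Sum>i\<in>UNIV. (\<Sum>l\<in>A. f l *s cvec (u l)) $ i * of_real (u m $ i)) =
        (\<Sum>l\<in>A. f l * of_real (u l \<bullet> u m))"
      by (simp add: inner_vec_def cvec_def sum_distrib_right sum_distrib_left mult.assoc)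
        (rule sum.swap)
    also have "\<dots> = f m * of_real (u m \<bullet> u m)"
      using fin m orth by (simp add: sum.remove[of _ m])
    finally show ?thesis .
  qed
  have "c m * of_real (u m \<bullet> u m) = d m * of_real (u m \<bullet> u m)"
    unfolding pair[symmetric] eq ..
  then show ?thesis using nz by simp
qed

text \<open>Eigenvectors of \<open>M\<close> are eigenvectors of each power, so both basis vectors
  are expanded in the eigenprojections of \<open>M\<close> itself and only the phases depend on
  \<open>k\<close>. This remains valid when distinct eigenvalues have equal \<open>k\<close>-th
  powers.\<close>

lemma pst_at_matpow_iff:
  assumes sym: "transpose M = M" and sc: "strongly_cospectral M a b"
  shows "pst_at (matpow M k) a b \<tau> \<longleftrightarrow> \<tau> > 0 \<and> (\<exists>\<gamma>. cmod \<gamma> = 1 \<and>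
    (\<forall>l\<in>eigsupp M (axis a 1). cis (- \<tau> * l ^ k) = \<gamma> * of_real (cosp_sign M a b l)))"
proof -
  let ?A = "eigsupp M (axis a 1)"
  define u where "u l = eigenproj M l (axis a 1)" for l
  let ?E = "mexp (map_matrix (\<lambda>z. - \<i> * of_real \<tau> * of_real z) (matpow M k))"
  have fin: "finite ?A" by (rule finite_eigsupp[OF sym])
  have ea: "axis a 1 = (\<Sum>l\<in>?A. cvec (u l))"
    unfolding u_def cvec_sum[symmetric] sum_eigenproj[OF sym] by (simp add: cvec_axis)
  have "axis b 1 = cvec (\<Sum>l\<in>eigsupp M (axis b 1). eigenproj M l (axis b 1))"
    unfolding sum_eigenproj[OF sym] by (simp add: cvec_axis)
  also have "eigsupp M (axis b 1) = ?A" using sc by (simp add: strongly_cospectral_def)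
  also have "cvec (\<Sum>l\<in>?A. eigenproj M l (axis b 1)) =
      (\<Sum>l\<in>?A. of_real (cosp_sign M a b l) *s cvec (u l))"
    unfolding cvec_sum u_def cvec_scale[symmetric]
    by (intro sum.cong refl) (simp add: strongly_cospectral_sign(2)[OF sc])
  finally have eb: "\<gamma> *s axis b 1 = (\<Sum>l\<in>?A. (\<gamma> * of_real (cosp_sign M a b l)) *s cvec (u l))" for \<gamma>
    by (simp add: vec.scale_sum_right vector_smult_assoc)
  have "?E *v cvec (u l) = cis (- \<tau> * l ^ k) *s cvec (u l)" for l
  proof -
    have "M *v u l = l *s u l" unfolding u_def by (rule eigenproj_eigenvector)
    from mexp_eigenvector[OF map_matrix_mult_cvec[OF matpow_eigenvector[OF this]],
        of "- \<i> * of_real \<tau>" k]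
    show ?thesis by (simp add: cis_conv_exp mult.assoc)
  qed
  then have Ea: "?E *v axis a 1 = (\<Sum>l\<in>?A. cis (- \<tau> * l ^ k) *s cvec (u l))"
    unfolding ea matrix_vector_mult_sum_right by simp
  have "?E *v axis a 1 = \<gamma> *s axis b 1 \<longleftrightarrow>
      (\<forall>l\<in>?A. cis (- \<tau> * l ^ k) = \<gamma> * of_real (cosp_sign M a b l))" for \<gamma>
  proof
    assume "?E *v axis a 1 = \<gamma> *s axis b 1"
    then have "(\<Sum>l\<in>?A. cis (- \<tau> * l ^ k) *s cvec (u l)) =
      (\<Sum>l\<in>?A. (\<gamma> * of_real (cosp_sign M a b l)) *s cvec (u l))"
      unfolding Ea eb .
    then show "\<forall>l\<in>?A. cis (- \<tau> * l ^ k) = \<gamma> * of_real (cosp_sign M a b l)"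
      by (intro ballI orthogonal_cvec_coeff_eq[OF fin])
        (auto simp: u_def eigsupp_def intro: eigenproj_orthogonal[OF sym])
  qed (simp only: Ea eb cong: sum.cong)
  then show ?thesis unfolding pst_at_def by simp
qed

lemma cis_eq_cis_iff: "cis x = cis y \<longleftrightarrow> (\<exists>n::int. x = y + 2 * pi * n)"
  using sin_cos_eq_iff[of x y] by (auto simp: complex_eq_iff)

text \<open>The common factor \<open>\<gamma>\<close> drops out, since only ratios of phases matter:
  equal signs require an even multiple of pi between the angles, opposite signs an odd one.\<close>

lemma pst_at_three_eigenvalues_iff:
  assumes sym: "transpose M = M" and sc: "strongly_cospectral M a b"
    and supp: "eigsupp M (axis a 1) = {x, y, z}"
    and outer: "cosp_sign M a b x = cosp_sign M a b z"
    and inner: "cosp_sign M a b y = - cosp_sign M a b z"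
  shows "pst_at (matpow M k) a b \<tau> \<longleftrightarrow> \<tau> > 0 \<and>
    (\<exists>m::int. \<tau> * (z ^ k - x ^ k) = 2 * pi * m) \<and>
    (\<exists>n::int. \<tau> * (z ^ k - y ^ k) = pi * of_int (2 * n + 1))"
proof -
  define s where "s = cosp_sign M a b z"
  have s: "s = 1 \<or> s = -1"
    using strongly_cospectral_sign(1)[OF sc, of z] supp by (auto simp: s_def)
  let ?c = "\<lambda>w. cis (- \<tau> * w ^ k)"
  have "(\<exists>\<gamma>. cmod \<gamma> = 1 \<and> (\<forall>l\<in>{x, y, z}. ?c l = \<gamma> * of_real (cosp_sign M a b l))) \<longleftrightarrow>
      ?c x = ?c z \<and> ?c y = - ?c z" (is "(\<exists>\<gamma>. ?P \<gamma>) \<longleftrightarrow> ?Q")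
  proof
    assume ?Q
    \<comment> \<open>The condition at \<open>z\<close> forces this choice of
      \<open>\<gamma>\<close>, because \<open>s * s = 1\<close>.\<close>
    then have "?P (?c z * of_real s)"
      using s by (auto simp: outer inner s_def[symmetric] norm_mult)
    then show "\<exists>\<gamma>. ?P \<gamma>" ..
  qed (auto simp: outer inner)
  moreover have "?c x = ?c z \<longleftrightarrow> (\<exists>m::int. \<tau> * (z ^ k - x ^ k) = 2 * pi * m)"
    unfolding cis_eq_cis_iff by (simp add: algebra_simps)
  moreover have "?c y = - ?c z \<longleftrightarrow> (\<exists>n::int. \<tau> * (z ^ k - y ^ k) = pi * of_int (2 * n + 1))"
  proof -
    have "- ?c z = cis (- \<tau> * z ^ k + pi)" by (simp add: complex_eq_iff)
    then have "?c y = - ?c z \<longleftrightarrow> (\<exists>n::int. - \<tau> * y ^ k = - \<tau> * z ^ k + pi + 2 * pi * n)"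
      by (simp only: cis_eq_cis_iff)
    then show ?thesis by (simp add: algebra_simps)
  qed
  ultimately show ?thesis unfolding pst_at_matpow_iff[OF sym sc] supp by simp
qed

section \<open>Powers of a quadratic irrational\<close>

text \<open>In lowest terms the denominator of a rational root would be 1, so \<open>D\<close> would
  be a perfect square; squarefreeness then makes its root a unit and \<open>D = 1\<close>.\<close>

lemma sqrt_squarefree_irrational:
  fixes D :: int
  assumes "D > 1" "squarefree D"
  shows "sqrt (of_int D) \<notin> \<rat>"
proof
  assume "sqrt (of_int D) \<in> \<rat>"
  then obtain m n :: nat where n: "n \<noteq> 0" and eq: "\<bar>sqrt (of_int D)\<bar> = real m / real n"
    and cop: "coprime m n"
    by (rule Rats_abs_nat_div_natE)
  have "sqrt (of_int D) * real n = real m" using eq n assms(1) by (simp add: field_simps)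
  then have "(sqrt (of_int D))\<^sup>2 * (real n)\<^sup>2 = (real m)\<^sup>2" by (metis power_mult_distrib)
  then have "of_int (D * (int n)\<^sup>2) = (of_int ((int m)\<^sup>2) :: real)" using assms(1) by simp
  then have D: "D * (int n)\<^sup>2 = (int m)\<^sup>2" by (simp only: of_int_eq_iff)
  then have "(int n)\<^sup>2 dvd (int m)\<^sup>2" by (metis dvd_triv_right)
  then have "n dvd m" by simp
  then have "n = 1" using cop by (metis coprime_common_divisor dvd_refl nat_dvd_1_iff_1)
  then have D': "D = (int m)\<^sup>2" using D by simp
  then have "int m dvd 1" using assms(2) squarefreeD[of D "int m"] by simp
  then have "m = 1" by simp
  then show False using D' assms(1) by simp
qed

text \<open>One recursion for \<open>P\<close> and \<open>Q\<close> serves both conjugates. As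
  \<open>p\<close> may be negative, signs are measured against powers of \<open>p\<close>; the
  exponent \<open>k + 1\<close> used for \<open>Q\<close> has the parity of \<open>k - 1\<close> and
  avoids truncated subtraction at \<open>k = 0\<close>.\<close>

lemma quadratic_power_decomp:
  fixes p q d :: real
  assumes rat: "p \<in> \<rat>" "q \<in> \<rat>" "d \<in> \<rat>" and pos: "q > 0" "d > 0" and p: "p \<noteq> 0"
  obtains P Q where "P \<in> \<rat>" "Q \<in> \<rat>" "(p + q * sqrt d) ^ k = P + Q * sqrt d"
    "(p - q * sqrt d) ^ k = P - Q * sqrt d"
    "k \<ge> 1 \<Longrightarrow> Q \<noteq> 0" "k \<ge> 2 \<Longrightarrow> P \<noteq> p ^ k"
proof -
  \<comment> \<open>The last two conjuncts keep track of signs: P has the sign of p ^ k and Q that of p ^ (k - 1).\<close>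
  have "\<exists>P Q. P \<in> \<rat> \<and> Q \<in> \<rat> \<and> (p + q * sqrt d) ^ k = P + Q * sqrt d \<and>
    (p - q * sqrt d) ^ k = P - Q * sqrt d \<and>
    p ^ k * P \<ge> (p ^ k)\<^sup>2 \<and> (k \<ge> 2 \<longrightarrow> p ^ k * P > (p ^ k)\<^sup>2) \<and>
    p ^ (k + 1) * Q \<ge> 0 \<and> (k \<ge> 1 \<longrightarrow> p ^ (k + 1) * Q > 0)"
  proof (induction k)
    case 0
    show ?case by (intro exI[of _ 1] exI[of _ 0]) auto
  next
    case (Suc k)
    then obtain P Q where IH: "P \<in> \<rat>" "Q \<in> \<rat>" "(p + q * sqrt d) ^ k = P + Q * sqrt d"
      "(p - q * sqrt d) ^ k = P - Q * sqrt d" and P: "p ^ k * P \<ge> (p ^ k)\<^sup>2"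
      and Q: "p ^ (k + 1) * Q \<ge> 0" "k \<ge> 1 \<Longrightarrow> p ^ (k + 1) * Q > 0" by blast
    have dd: "sqrt d * sqrt d = d" using pos by simp
    define P' Q' where "P' = p * P + q * d * Q" and "Q' = q * P + p * Q"
    have "P' \<in> \<rat>" "Q' \<in> \<rat>" unfolding P'_def Q'_def using rat IH(1,2) by simp_all
    moreover have "(p + q * sqrt d) ^ Suc k = P' + Q' * sqrt d"
    proof -
      have "(p + q * sqrt d) ^ Suc k = p * P + q * Q * (sqrt d * sqrt d) + (q * P + p * Q) * sqrt d"
        unfolding power_Suc IH(3) by (simp add: algebra_simps)
      then show ?thesis unfolding dd by (simp add: P'_def Q'_def algebra_simps)
    qed
    moreover have "(p - q * sqrt d) ^ Suc k = P' - Q' * sqrt d"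
    proof -
      have "(p - q * sqrt d) ^ Suc k = p * P + q * Q * (sqrt d * sqrt d) - (q * P + p * Q) * sqrt d"
        unfolding power_Suc IH(4) by (simp add: algebra_simps)
      then show ?thesis unfolding dd by (simp add: P'_def Q'_def algebra_simps)
    qed
    \<comment> \<open>The old surplus is scaled by \<open>p\<^sup>2\<close>, and a term is added
      that is positive once \<open>k \<ge> 1\<close>; hence strictness sets in at exponent
      2.\<close>
    moreover have P': "p ^ Suc k * P' - (p ^ Suc k)\<^sup>2 =
        p\<^sup>2 * (p ^ k * P - (p ^ k)\<^sup>2) + q * d * (p ^ (k + 1) * Q)"
      by (simp add: P'_def algebra_simps power2_eq_square)
    have "p\<^sup>2 * (p ^ k * P - (p ^ k)\<^sup>2) \<ge> 0" using P by simp
    moreover have "q * d * (p ^ (k + 1) * Q) \<ge> 0"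
      using mult_nonneg_nonneg[OF mult_nonneg_nonneg[OF less_imp_le less_imp_le, OF pos] Q(1)] .
    moreover have "q * d * (p ^ (k + 1) * Q) > 0" if "Suc k \<ge> 2"
      using mult_pos_pos[OF mult_pos_pos[OF pos] Q(2)] that by simp
    moreover have Q': "p ^ (Suc k + 1) * Q' = q * p\<^sup>2 * (p ^ k * P) + p\<^sup>2 * (p ^ (k + 1) * Q)"
      by (simp add: Q'_def algebra_simps power2_eq_square)
    moreover have "q * p\<^sup>2 * (p ^ k * P) > 0"
    proof -
      have "(p ^ k)\<^sup>2 > 0" using p by simp
      then have "p ^ k * P > 0" using P by linarith
      then show ?thesis using p pos by simp
    qed
    moreover have "p\<^sup>2 * (p ^ (k + 1) * Q) \<ge> 0"
      using mult_nonneg_nonneg[OF zero_le_power2 Q(1)] .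
    ultimately have "P' \<in> \<rat> \<and> Q' \<in> \<rat> \<and> (p + q * sqrt d) ^ Suc k = P' + Q' * sqrt d \<and>
      (p - q * sqrt d) ^ Suc k = P' - Q' * sqrt d \<and>
      p ^ Suc k * P' \<ge> (p ^ Suc k)\<^sup>2 \<and> (Suc k \<ge> 2 \<longrightarrow> p ^ Suc k * P' > (p ^ Suc k)\<^sup>2) \<and>
      p ^ (Suc k + 1) * Q' \<ge> 0 \<and> (Suc k \<ge> 1 \<longrightarrow> p ^ (Suc k + 1) * Q' > 0)"
      using P' by (intro conjI impI) (assumption | linarith)+
    then show ?case by blast
  qed
  then obtain P Q where PQ: "P \<in> \<rat>" "Q \<in> \<rat>" "(p + q * sqrt d) ^ k = P + Q * sqrt d"
    "(p - q * sqrt d) ^ k = P - Q * sqrt d"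
    "k \<ge> 2 \<longrightarrow> p ^ k * P > (p ^ k)\<^sup>2" "k \<ge> 1 \<longrightarrow> p ^ (k + 1) * Q > 0" by blast
  have "Q \<noteq> 0" if "k \<ge> 1" using PQ(6) that by auto
  moreover have "P \<noteq> p ^ k" if "k \<ge> 2" using PQ(5) that by (auto simp: power2_eq_square)
  ultimately show ?thesis using that PQ(1-4) by blast
qed

section \<open>Admissible powers and the minimum transfer time\<close>

theorem theorem6p1:
  fixes M :: "real^'v^'v" and a b :: 'v and a0 b0 :: real and \<Delta> :: int
  assumes "transpose M = M"
    and "a \<noteq> b"
    and "strongly_cospectral M a b"
    and "a0 \<in> \<rat>" "b0 \<in> \<rat>" "b0 > 0"
    and "\<Delta> > 1" "squarefree \<Delta>"
    and "eigsupp M (axis a 1) =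
           {a0 - b0 * sqrt (of_int \<Delta>), a0, a0 + b0 * sqrt (of_int \<Delta>)}"
    and "cosp_sign M a b (a0 - b0 * sqrt (of_int \<Delta>)) =
         cosp_sign M a b (a0 + b0 * sqrt (of_int \<Delta>))"
    and "cosp_sign M a b a0 = - cosp_sign M a b (a0 + b0 * sqrt (of_int \<Delta>))"
  shows "pst_powers M a b = (if a0 = 0 then {k. k \<ge> 1} else {1}) \<and>
         (a0 \<noteq> 0 \<longrightarrow>
            pst_at M a b (pi / (b0 * sqrt (of_int \<Delta>))) \<and>
            (\<forall>\<tau>. pst_at M a b \<tau> \<longrightarrow> pi / (b0 * sqrt (of_int \<Delta>)) \<le> \<tau>))"
proof -
  let ?d = "sqrt (of_int \<Delta>)"
  define r where "r = b0 * ?d"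
  have d: "?d > 0" using assms(7) by simp
  have r: "r > 0" unfolding r_def using d assms(6) by simp
  have irr: "?d \<notin> \<rat>" using sqrt_squarefree_irrational assms(7,8) .
  note iff = pst_at_three_eigenvalues_iff[OF assms(1,3,9,10,11), folded r_def]
  have M1: "matpow M 1 = M" by simp
  have time: "pst_at M a b (pi / r)"
  proof -
    have "pst_at (matpow M 1) a b (pi / r)"
      \<comment> \<open>The outer gap \<open>2 * r\<close> gives \<open>m = 1\<close>, and the gap
        \<open>r\<close> to the centre gives \<open>n = 0\<close>.\<close>
      unfolding iff using r by (auto intro!: exI[of _ "1::int"] exI[of _ "0::int"])
    then show ?thesis unfolding M1 .
  qed
  have min: "pi / r \<le> \<tau>" if pst: "pst_at M a b \<tau>" for \<tau>
  proof -
    have "pst_at (matpow M 1) a b \<tau>" unfolding M1 by (rule pst)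
    then obtain n :: int where t: "\<tau> > 0" and n: "\<tau> * r = pi * of_int (2 * n + 1)"
      unfolding iff by auto
    \<comment> \<open>A positive odd multiple of pi is at least pi, which bounds
      \<open>\<tau>\<close> from below.\<close>
    have "\<tau> * r > 0" using t r by simp
    then have "0 < pi * real_of_int (2 * n + 1)" unfolding n by simp
    then have "real_of_int (2 * n + 1) > 0" by (simp only: zero_less_mult_iff) (auto simp: less_imp_le)
    then have "2 * n + 1 \<ge> 1" by linarith
    then have "pi * 1 \<le> pi * real_of_int (2 * n + 1)" using pi_ge_zero by (intro mult_left_mono) linarith+
    then have "pi \<le> \<tau> * r" unfolding n by simp
    then show ?thesis using r by (simp add: field_simps)
  qed
  have zero: "pst (matpow M k) a b" if "a0 = 0" "k \<ge> 1" for k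
  proof -
    \<comment> \<open>With centre 0 the eigenvalue powers are 0 and, up to sign,
      \<open>r ^ k\<close>; this time turns the gap \<open>r ^ k\<close> into pi.\<close>
    have "pst_at (matpow M k) a b (pi / r ^ k)"
      unfolding iff
    proof (intro conjI)
      show "pi / r ^ k > 0" using r by simp
      show "\<exists>n::int. pi / r ^ k * ((a0 + r) ^ k - a0 ^ k) = pi * real_of_int (2 * n + 1)"
        using that r by (intro exI[of _ 0]) (simp add: zero_power)
      show "\<exists>m::int. pi / r ^ k * ((a0 + r) ^ k - (a0 - r) ^ k) = 2 * pi * real_of_int m"
      \<comment> \<open>The outer powers coincide for even \<open>k\<close> and differ by
        \<open>2 * r ^ k\<close> for odd \<open>k\<close>.\<close>
      proof (cases "even k")
        case True
        then show ?thesis using that by (intro exI[of _ 0]) simp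
      next
        case False
        then show ?thesis using that r by (intro exI[of _ 1]) simp
      qed
    qed
    then show ?thesis unfolding pst_def by blast
  qed
  have nonzero: "k = 1" if a0: "a0 \<noteq> 0" and k1: "k \<ge> 1" and pst: "pst (matpow M k) a b" for k
  proof (rule ccontr)
    assume "k \<noteq> 1"
    then have k: "k \<ge> 2" using k1 by simp
    obtain P Q where PQ: "P \<in> \<rat>" "Q \<in> \<rat>" "(a0 + r) ^ k = P + Q * ?d" "(a0 - r) ^ k = P - Q * ?d"
      and nz: "Q \<noteq> 0" "P \<noteq> a0 ^ k"
      using quadratic_power_decomp[of a0 b0 "of_int \<Delta>" k] assms(4-7) a0 k1 k
      unfolding r_def by auto
    obtain \<tau> and m n :: int where t: "\<tau> > 0"
      and m: "\<tau> * (2 * Q * ?d) = 2 * pi * m" and n: "\<tau> * (P - a0 ^ k + Q * ?d) = pi * of_int (2 * n + 1)"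
      using pst unfolding pst_def iff PQ(3,4) by (auto simp: algebra_simps)
    have m': "\<tau> * (Q * ?d) = pi * m" using m by simp
    have "m \<noteq> 0" using m' t d nz by auto
    \<comment> \<open>Dividing the two conditions eliminates the transfer time and expresses the irrational
      square root through rational numbers.\<close>
    have "\<tau> * (P - a0 ^ k) = pi * of_int (2 * n + 1 - m)"
      using n m' by (simp add: algebra_simps)
    then have "(\<tau> * (P - a0 ^ k)) * (pi * m) = (pi * of_int (2 * n + 1 - m)) * (\<tau> * (Q * ?d))"
      using m' by simp
    then have "(P - a0 ^ k) * m = of_int (2 * n + 1 - m) * Q * ?d"
      using t by (simp add: mult.assoc mult.left_commute)
    \<comment> \<open>The left-hand side of the preceding equation is nonzero because
      \<open>P\<close> differs from \<open>a0 ^ k\<close>; this is where \<open>k \<ge> 2\<close>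
      enters, and it licenses the division.\<close>
    moreover from this have "real_of_int (2 * n + 1 - m) * Q \<noteq> 0" using nz \<open>m \<noteq> 0\<close> by auto
    ultimately have "?d = (P - a0 ^ k) * m / (of_int (2 * n + 1 - m) * Q)" by (simp add: field_simps)
    also have "\<dots> \<in> \<rat>" using PQ(1,2) assms(4) by (intro Rats_divide Rats_mult Rats_diff Rats_power Rats_add) auto
    finally show False using irr by simp
  qed
  have "pst (matpow M 1) a b" using time unfolding M1 pst_def by blast
  then have "pst_powers M a b = (if a0 = 0 then {k. k \<ge> 1} else {1})"
    using zero nonzero unfolding pst_powers_def by (auto simp del: matpow.simps)
  then show ?thesis using time min unfolding r_def by simp
qed

end
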